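(* Let $\Theta=[0,1]$, let $X,X_1,X_2,\dots\in[0,1]$ be i.i.d. with mean $\theta^*$ and variance $\sigma^2>0$, and let $\lambda_t(\theta)$ ($t\ge1$, $\theta\in\Theta$) be a predictable betting strategy with log-wealth $w_n(\theta)=\sum_{t=1}^n\log(1+\lambda_t(\theta)(X_t-\theta))$. Suppose that $\frac1nw_n(\theta)$ converges uniformly over $\theta\in\Theta$ in probability to a continuous limit function $$M(\theta)=\mathbb E_{\theta^*}[\log(1+\lambda^*(\theta)(X-\theta))]$$ for some function $\lambda^*$ on $\Theta$ (the asymptotic bet fraction). If $\lambda^*(\theta^* )=0$ and $$\inf_{\theta\in\Theta:\,|\theta-\theta^*|\ge\varepsilon}\mathbb E_{\theta^*}[\log(1+\lambda^*(\theta)(X-\theta))]>0\qquad\text{for all }\varepsilon>0,$$ then any sequence of ME-estimators $\tilde\theta_n^{(E)}\in\arg\min_{\theta\in\Theta}w_n(\theta)$ is consistent: $\tilde\theta_n^{(E)}\xrightarrow{p}\theta^*$.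
   Context: Bounded betting: for each $\theta\in[0,1]$, the betting wealth is $W_n^\theta=\prod_{t=1}^n(1+\lambda_t(\theta)(X_t-\theta))$, where the bet fraction $\lambda_t(\theta)\in[-\frac1{1-\theta},\frac1\theta]$ (with $1/0=+\infty$) is real-valued and predictable, i.e. a (measurable) function of $X_1,\dots,X_{t-1}$. An ME-estimator is any minimizer over $\theta\in[0,1]$ of $W_n^\theta$, equivalently of $w_n(\theta)=\log W_n^\theta$, assumed to exist. $\mathbb E_{\theta^*}$ denotes expectation under the true data distribution. Uniform convergence in probability means $\sup_{\theta\in\Theta}|\frac1nw_n(\theta)-M(\theta)|\xrightarrow{p}0$. *)

theory Defs
  imports "HOL-Probability.Probability"
begin

text \<open>
  A gambler may go bankrupt: a bet at an end point of its admissible range can make a wealth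
  factor zero. Log-wealth is therefore extended-real-valued with \<open>log 0 = -\<infinity>\<close>, unlike
  \<^const>\<open>ln\<close>, for which \<open>ln 0 = 0\<close>. Negative arguments, where the logarithm is
  undefined, are also sent to \<open>-\<infinity>\<close>.
\<close>

definition elog :: "real \<Rightarrow> ereal" where
  "elog x = (if x > 0 then ereal (ln x) else -\<infinity>)"

text \<open>
  Expectation \<open>E[Y] = E[Y\<^sup>+] - E[Y\<^sup>-]\<close> of an extended-real-valued variable. The form
  \<open>\<infinity> - \<infinity>\<close> does not occur below, as it is only applied to variables with an almost sure
  finite upper bound.
\<close>

definition eexpectation :: "'a measure \<Rightarrow> ('a \<Rightarrow> ereal) \<Rightarrow> ereal" where
  "eexpectation M Y =
     enn2ereal (\<integral>\<^sup>+\<omega>. e2ennreal (Y \<omega>) \<partial>M) - enn2ereal (\<integral>\<^sup>+\<omega>. e2ennreal (- Y \<omega>) \<partial>M)"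

text \<open>
  \<open>lam t \<theta> x\<close> is the fraction bet in round \<open>t\<close> against the candidate mean \<open>\<theta>\<close> after the
  history \<open>x = (x\<^sub>1, \<dots>, x\<^sub>t\<^sub>-\<^sub>1)\<close>, represented as a function with index set \<open>{1..<t}\<close>. In the
  bounds, \<open>1 / 0 = \<infinity>\<close> holds for \<^typ>\<open>ereal\<close>, so the range is one-sided for \<open>\<theta> \<in> {0, 1}\<close>.
\<close>

definition betting_strategy :: "(nat \<Rightarrow> real \<Rightarrow> (nat \<Rightarrow> real) \<Rightarrow> real) \<Rightarrow> bool" where
  "betting_strategy lam \<longleftrightarrow>
     (\<forall>t\<ge>1. \<forall>\<theta>\<in>{0..1}.
        lam t \<theta> \<in> borel_measurable (Pi\<^sub>M {1..<t} (\<lambda>_. borel)) \<and>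
        (\<forall>x \<in> {1..<t} \<rightarrow>\<^sub>E {0..1}.
           - (1 / (1 - ereal \<theta>)) \<le> ereal (lam t \<theta> x) \<and> ereal (lam t \<theta> x) \<le> 1 / ereal \<theta>))"

definition log_wealth ::
  "(nat \<Rightarrow> real \<Rightarrow> (nat \<Rightarrow> real) \<Rightarrow> real) \<Rightarrow> (nat \<Rightarrow> 'a \<Rightarrow> real) \<Rightarrow> nat \<Rightarrow> real \<Rightarrow> 'a \<Rightarrow> ereal" where
  "log_wealth lam Xs n \<theta> \<omega> =
     (\<Sum>t = 1..n. elog (1 + lam t \<theta> (\<lambda>i\<in>{1..<t}. Xs i \<omega>) * (Xs t \<omega> - \<theta>)))"

text \<open>
  Neither a supremum over uncountably many \<open>\<theta>\<close> nor a selection of minimizers need be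
  measurable, so convergence in probability is stated with the outer probability. On measurable
  events this is the probability itself, which gives the usual notion for random variables.
\<close>

definition conv_in_prob :: "'a measure \<Rightarrow> (nat \<Rightarrow> 'a \<Rightarrow> real) \<Rightarrow> real \<Rightarrow> bool" where
  "conv_in_prob M Y c \<longleftrightarrow>
     (\<forall>\<epsilon>>0. (\<lambda>n. outer_measure_of M {\<omega> \<in> space M. \<bar>Y n \<omega> - c\<bar> > \<epsilon>}) \<longlonglongrightarrow> 0)"

definition uniform_conv_in_prob ::
  "'a measure \<Rightarrow> 'b set \<Rightarrow> (nat \<Rightarrow> 'b \<Rightarrow> 'a \<Rightarrow> ereal) \<Rightarrow> ('b \<Rightarrow> real) \<Rightarrow> bool" where
  "uniform_conv_in_prob M \<Theta> f g \<longleftrightarrow>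
     (\<forall>\<epsilon>>0. (\<lambda>n. outer_measure_of M
        {\<omega> \<in> space M. (SUP \<theta>\<in>\<Theta>. \<bar>f n \<theta> \<omega> - ereal (g \<theta>)\<bar>) > ereal \<epsilon>}) \<longlonglongrightarrow> 0)"

end

theory Submission
  imports Defs
begin

text \<open>
  Since \<open>\<lambda>\<^sup>*(\<theta>\<^sup>*) = 0\<close>, the limit vanishes at \<open>\<theta>\<^sup>*\<close>, and by hypothesis it exceeds some \<open>c > 0\<close>
  outside the \<open>\<epsilon>\<close>-neighbourhood of \<open>\<theta>\<^sup>*\<close>. Whenever the normalised log-wealth is uniformly within
  \<open>c / 3\<close> of the limit, its value at \<open>\<theta>\<^sup>*\<close> is smaller than any value outside the neighbourhood, so
  the minimizer lies inside.
\<close>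

text \<open>Every measurable cover of \<open>B\<close> becomes a cover of \<open>A\<close> once the
  exceptional null set is added, at no cost in measure. The outer form is needed because the events
  compared below may be non-measurable, while the minimizing property holds only almost
  surely.\<close>

lemma outer_measure_of_mono_AE:
  assumes "AE \<omega> in M. \<omega> \<in> A \<longrightarrow> \<omega> \<in> B" and "A \<subseteq> space M"
  shows "outer_measure_of M A \<le> outer_measure_of M B"
proof -
  obtain N where N: "N \<in> null_sets M" "{\<omega> \<in> space M. \<not> (\<omega> \<in> A \<longrightarrow> \<omega> \<in> B)} \<subseteq> N"
    using assms(1) by (auto simp: eventually_ae_filter)
  have "outer_measure_of M A \<le> emeasure M C" if C: "C \<in> sets M" "B \<subseteq> C" for C
  proof -
    have "A \<subseteq> C \<union> N" using N(2) assms(2) C(2) by auto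
    then have "outer_measure_of M A \<le> emeasure M (C \<union> N)"
      unfolding outer_measure_of_def using C(1) N(1) by (intro INF_lower) auto
    also have "\<dots> = emeasure M C" by (rule emeasure_Un_null_set[OF C(1) N(1)])
    finally show ?thesis .
  qed
  then show ?thesis unfolding outer_measure_of_def[of _ B] by (auto intro: INF_greatest)
qed

lemma (in prob_space) expectation_in_unit_interval:
  fixes X :: "'a \<Rightarrow> real"
  assumes "X \<in> borel_measurable M" and "AE \<omega> in M. X \<omega> \<in> {0..1}"
  shows "expectation X \<in> {0..1}"
proof -
  have "integrable M X"
    by (rule integrable_const_bound[where B = 1]) (use assms in auto)
  then show ?thesis
    using integral_ge_const[of X 0] integral_le_const[of X 1] assms(2) by auto
qed

text \<open>A finite radius excludes infinite \<open>x\<close>, whose distance to \<open>m\<close>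
  would be \<infinity>; what remains is real arithmetic.\<close>

lemma ereal_abs_diff_le_bounds:
  fixes x :: ereal and m r :: real
  assumes "\<bar>x - ereal m\<bar> \<le> ereal r"
  shows "ereal (m - r) \<le> x" and "x \<le> ereal (m + r)"
proof -
  show "ereal (m - r) \<le> x" using assms by (cases x) auto
  show "x \<le> ereal (m + r)" using assms by (cases x) auto
qed

theorem theorem3p1:
  fixes P :: "'a measure"
    and X :: "'a \<Rightarrow> real"
    and Xs :: "nat \<Rightarrow> 'a \<Rightarrow> real"
    and \<theta>s \<sigma> :: real
    and lam :: "nat \<Rightarrow> real \<Rightarrow> (nat \<Rightarrow> real) \<Rightarrow> real"
    and lams :: "real \<Rightarrow> real"
    and M :: "real \<Rightarrow> real"
    and \<theta>E :: "nat \<Rightarrow> 'a \<Rightarrow> real"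
  assumes "prob_space P"
    and "X \<in> borel_measurable P"
    and "AE \<omega> in P. X \<omega> \<in> {0..1}"
    and "prob_space.indep_vars P (\<lambda>_. borel) Xs {1..}"
    and "\<And>t. t \<ge> 1 \<Longrightarrow> distr P borel (Xs t) = distr P borel X"
    and "prob_space.expectation P X = \<theta>s"
    and "prob_space.variance P X = \<sigma>\<^sup>2"
    and "\<sigma>\<^sup>2 > 0"
    and "betting_strategy lam"
    and "uniform_conv_in_prob P {0..1} (\<lambda>n \<theta> \<omega>. log_wealth lam Xs n \<theta> \<omega> / ereal (real n)) M"
    and "continuous_on {0..1} M"
    and "\<And>\<theta>. \<theta> \<in> {0..1} \<Longrightarrow>
           ereal (M \<theta>) = eexpectation P (\<lambda>\<omega>. elog (1 + lams \<theta> * (X \<omega> - \<theta>)))"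
    and "lams \<theta>s = 0"
    and "\<And>\<epsilon>. \<epsilon> > 0 \<Longrightarrow>
           (INF \<theta> \<in> {\<theta> \<in> {0..1}. \<bar>\<theta> - \<theta>s\<bar> \<ge> \<epsilon>}.
              eexpectation P (\<lambda>\<omega>. elog (1 + lams \<theta> * (X \<omega> - \<theta>)))) > 0"
    and "\<And>n. n \<ge> 1 \<Longrightarrow>
           AE \<omega> in P. is_arg_min (\<lambda>\<theta>. log_wealth lam Xs n \<theta> \<omega>) (\<lambda>\<theta>. \<theta> \<in> {0..1}) (\<theta>E n \<omega>)"
  shows "conv_in_prob P \<theta>E \<theta>s"
  unfolding conv_in_prob_def
proof (intro allI impI)
  interpret prob_space P by fact
  fix \<epsilon> :: real assume \<epsilon>: "\<epsilon> > 0"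
  let ?w = "\<lambda>n \<theta> \<omega>. log_wealth lam Xs n \<theta> \<omega> / ereal (real n)"
  \<comment> \<open>Membership makes \<open>\<theta>s\<close> a competitor of the minimizer and lets
    the formula for \<open>M\<close> apply there.\<close>
  have \<theta>s: "\<theta>s \<in> {0..1}"
    using expectation_in_unit_interval[OF assms(2,3)] assms(6) by simp
  have "eexpectation P (\<lambda>\<omega>. elog (1 + lams \<theta>s * (X \<omega> - \<theta>s))) = 0"
    using \<open>lams \<theta>s = 0\<close> by (simp add: elog_def eexpectation_def)
  with assms(12)[OF \<theta>s] have M\<theta>s: "M \<theta>s = 0" by simp
  obtain c where c: "c > 0" and M_gt: "\<And>\<theta>. \<theta> \<in> {0..1} \<Longrightarrow> \<bar>\<theta> - \<theta>s\<bar> \<ge> \<epsilon> \<Longrightarrow> c < M \<theta>"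
  proof -
    \<comment> \<open>Density of the reals yields a finite \<open>c\<close> even if the infimum is
      \<infinity>, as it is when no candidate lies at distance at least
      \<open>\<epsilon>\<close>.\<close>
    obtain c where "0 < ereal c"
      and c: "ereal c < (INF \<theta> \<in> {\<theta> \<in> {0..1}. \<bar>\<theta> - \<theta>s\<bar> \<ge> \<epsilon>}.
                eexpectation P (\<lambda>\<omega>. elog (1 + lams \<theta> * (X \<omega> - \<theta>))))"
      using ereal_dense2[OF assms(14)[OF \<epsilon>]] by blast
    have "c < M \<theta>" if "\<theta> \<in> {0..1}" "\<bar>\<theta> - \<theta>s\<bar> \<ge> \<epsilon>" for \<theta>
    proof -
      have "ereal c < ereal (M \<theta>)"
        unfolding assms(12)[OF that(1)] by (rule less_INF_D[OF c]) (use that in auto)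
      then show ?thesis by simp
    qed
    with \<open>0 < ereal c\<close> show ?thesis by (intro that[of c]) auto
  qed
  let ?B = "\<lambda>n. {\<omega> \<in> space P. (SUP \<theta>\<in>{0..1}. \<bar>?w n \<theta> \<omega> - ereal (M \<theta>)\<bar>) > ereal (c / 3)}"
  let ?A = "\<lambda>n. {\<omega> \<in> space P. \<bar>\<theta>E n \<omega> - \<theta>s\<bar> > \<epsilon>}"
  have "outer_measure_of P (?A n) \<le> outer_measure_of P (?B n)" if n: "n \<ge> 1" for n
  proof (rule outer_measure_of_mono_AE)
    show "AE \<omega> in P. \<omega> \<in> ?A n \<longrightarrow> \<omega> \<in> ?B n"
    proof (rule eventually_mono[OF assms(15)[OF n]], rule impI, rule ccontr)
      fix \<omega>
      assume argmin: "is_arg_min (\<lambda>\<theta>. log_wealth lam Xs n \<theta> \<omega>) (\<lambda>\<theta>. \<theta> \<in> {0..1}) (\<theta>E n \<omega>)"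
        and A: "\<omega> \<in> ?A n" and B: "\<omega> \<notin> ?B n"
      have \<theta>E: "\<theta>E n \<omega> \<in> {0..1}" using argmin by (simp add: is_arg_min_def)
      \<comment> \<open>Uniformity is essential here: the bound is applied at
        \<open>\<theta>E n \<omega>\<close>, which varies with the outcome.\<close>
      have close: "\<bar>?w n \<theta> \<omega> - ereal (M \<theta>)\<bar> \<le> ereal (c / 3)" if "\<theta> \<in> {0..1}" for \<theta>
      proof (rule order_trans[OF SUP_upper[OF that]])
        show "(SUP \<theta>\<in>{0..1}. \<bar>?w n \<theta> \<omega> - ereal (M \<theta>)\<bar>) \<le> ereal (c / 3)"
          using A B by (simp only: mem_Collect_eq not_less simp_thms)
      qed
      have "?w n \<theta>s \<omega> \<le> ereal (c / 3)"
        using ereal_abs_diff_le_bounds(2)[OF close[OF \<theta>s]] M\<theta>s by simp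
      \<comment> \<open>On \<open>?A n\<close> the limit at the minimizer exceeds \<open>c\<close>,
        so the right side exceeds \<open>2 * c / 3\<close>.\<close>
      also have "\<dots> < ereal (M (\<theta>E n \<omega>) - c / 3)"
        using M_gt[OF \<theta>E] A c by simp
      also have "\<dots> \<le> ?w n (\<theta>E n \<omega>) \<omega>"
        by (rule ereal_abs_diff_le_bounds(1)[OF close[OF \<theta>E]])
      finally have less: "?w n \<theta>s \<omega> < ?w n (\<theta>E n \<omega>) \<omega>" .
      have "log_wealth lam Xs n (\<theta>E n \<omega>) \<omega> \<le> log_wealth lam Xs n \<theta>s \<omega>"
        using argmin \<theta>s by (auto simp: is_arg_min_def not_less)
      \<comment> \<open>Normalising preserves the order because \<open>n\<close> is
        positive.\<close>
      then have "?w n (\<theta>E n \<omega>) \<omega> \<le> ?w n \<theta>s \<omega>"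
        using n by (intro ereal_divide_right_mono) auto
      with less show False by simp
    qed
  qed auto
  \<comment> \<open>The comparison was shown for \<open>n \<ge> 1\<close> only, which suffices for
    the limit.\<close>
  then have le: "\<forall>\<^sub>F n in sequentially. outer_measure_of P (?A n) \<le> outer_measure_of P (?B n)"
    by (rule eventually_sequentiallyI)
  have "c / 3 > 0" using c by simp
  then have lim: "(\<lambda>n. outer_measure_of P (?B n)) \<longlonglongrightarrow> 0"
    using assms(10) unfolding uniform_conv_in_prob_def by blast
  show "(\<lambda>n. outer_measure_of P (?A n)) \<longlonglongrightarrow> 0"
    by (rule tendsto_sandwich[OF _ le tendsto_const lim]) simp
qed

end
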